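(* Let $(X,\langle\cdot|\cdot\rangle)$ be a complex inner product space and let $n\in\mathbb N$. The following two properties are equivalent. (1) There is an orthonormal system $T=\{x_1,x_2,\dots,x_n\}\subset X$ of $n$ vectors. (2) There exists a set $B=\{v_1,v_2,\dots,v_n\}\subset X$ of $n$ elements such that $B$ is $\mathbb R$-linearly independent and $B\times B\subset\mathcal R_X$, i.e. all angles in $B$ are real.
   Context: $\mathbb N=\{1,2,3,\dots\}$. A complex inner product is homogeneous over $\mathbb C$ in the first component, conjugate symmetric, positive definite and additive, and $\|x\|=\sqrt{\langle x|x\rangle}$. An orthonormal system is a nonempty subset $T\subset X$ with $\langle x|y\rangle=0$ for all distinct $x,y\in T$ and $\langle x|x\rangle=1$ for all $x\in T$. $\mathcal R_X:=\{(x,y)\in X\times X\mid\langle x|y\rangle\in\mathbb R\}$. For $x,y\in X\setminus\{0\}$ the angle is $\angle(x,y):=\arccos\big(\langle x|y\rangle/(\|x\|\,\|y\|)\big)$, where $\arccos:\mathcal B\to\mathcal A$ is the inverse of the homeomorphism $\cos:\mathcal A\to\mathcal B$ obtained by restricting the complex cosine, with $\mathcal A:=\{a+ib\mid 0<a<\pi,\ b\in\mathbb R\}\cup\{0,\pi\}$ and $\mathcal B:=\mathbb C\setminus\{r\in\mathbb R\mid r<-1\text{ or }r>1\}$. For nonzero $x,y$ the angle is real if and only if $\langle x|y\rangle\in\mathbb R$. *)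

theory Defs
  imports "HOL-Analysis.Analysis"
begin

class complex_vector = ab_group_add + scaleR +
  fixes scaleC :: "complex \<Rightarrow> 'a \<Rightarrow> 'a" (infixr "*\<^sub>C" 75)
  assumes scaleC_add_right: "a *\<^sub>C (x + y) = a *\<^sub>C x + a *\<^sub>C y"
    and scaleC_add_left: "(a + b) *\<^sub>C x = a *\<^sub>C x + b *\<^sub>C x"
    and scaleC_scaleC: "a *\<^sub>C (b *\<^sub>C x) = (a * b) *\<^sub>C x"
    and scaleC_one: "1 *\<^sub>C x = x"
    (* The real structure is the restriction of scalars, so the library's real
       linear independence is R-linear independence in the complex space. *)
    and scaleR_scaleC: "r *\<^sub>R x = complex_of_real r *\<^sub>C x"
begin

subclass real_vector
proof
  fix a b :: real and x y :: 'a
  show "a *\<^sub>R (x + y) = a *\<^sub>R x + a *\<^sub>R y"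
    by (simp add: scaleR_scaleC scaleC_add_right)
  show "(a + b) *\<^sub>R x = a *\<^sub>R x + b *\<^sub>R x"
    by (simp add: scaleR_scaleC scaleC_add_left)
  show "a *\<^sub>R b *\<^sub>R x = (a * b) *\<^sub>R x"
    by (simp add: scaleR_scaleC scaleC_scaleC)
  show "1 *\<^sub>R x = x"
    by (simp add: scaleR_scaleC scaleC_one)
qed

end

(* Conjugate symmetry makes "cinner x x" real, so "Re (cinner x x)" is that value. *)
class complex_inner = complex_vector +
  fixes cinner :: "'a \<Rightarrow> 'a \<Rightarrow> complex"
  assumes cinner_add_left: "cinner (x + y) z = cinner x z + cinner y z"
    and cinner_scaleC_left: "cinner (a *\<^sub>C x) y = a * cinner x y"
    and cinner_commute: "cinner y x = cnj (cinner x y)"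
    and cinner_pos: "x \<noteq> 0 \<Longrightarrow> Re (cinner x x) > 0"

definition orthonormal_system :: "'a::complex_inner set \<Rightarrow> bool" where
  "orthonormal_system T \<longleftrightarrow>
     T \<noteq> {} \<and> (\<forall>x\<in>T. \<forall>y\<in>T. x \<noteq> y \<longrightarrow> cinner x y = 0) \<and> (\<forall>x\<in>T. cinner x x = 1)"

definition real_pairs :: "('a::complex_inner \<times> 'a) set" where
  "real_pairs = {(x, y). cinner x y \<in> \<real>}"

(* The angle does not occur in "real_pairs"; it enters through
   all_angles_real_iff below. *)
definition cnorm :: "'a::complex_inner \<Rightarrow> real" where
  "cnorm x = sqrt (Re (cinner x x))"

definition arccos_dom :: "complex set" where
  "arccos_dom = - {of_real r | r. r < -1 \<or> r > 1}"

definition angle_range :: "complex set" where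
  "angle_range = {z. 0 < Re z \<and> Re z < pi} \<union> {0, of_real pi}"

lemma bij_betw_cos_angle_range: "bij_betw cos angle_range arccos_dom"
proof -
  have "inj_on cos angle_range"
  proof (rule inj_on_inverseI)
    fix z assume "z \<in> angle_range"
    then show "Arccos (cos z) = z"
      by (intro Arccos_cos) (auto simp: angle_range_def)
  qed
  moreover have "cos z \<in> arccos_dom" if z: "z \<in> angle_range" for z
  proof (rule ccontr)
    assume "cos z \<notin> arccos_dom"
    then obtain r where r: "cos z = complex_of_real r" "r < -1 \<or> r > 1"
      by (auto simp: arccos_dom_def)
    have "Im (cos z) = 0"
      using r by simp
    then have "sin (Re z) * (exp (- Im z) - exp (Im z)) = 0"
      by (simp add: Im_cos)
    moreover have "sin (Re z) > 0" if "0 < Re z" "Re z < pi"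
      using that by (rule sin_gt_zero)
    ultimately have "Im z = 0"
      using z by (auto simp: angle_range_def)
    then have "cos z = complex_of_real (cos (Re z))"
      by (simp add: complex_is_Real_iff cos_of_real complex_eq_iff Re_cos Im_cos)
    then have "r = cos (Re z)"
      using r by simp
    then show False
      using r(2) cos_ge_minus_one[of "Re z"] cos_le_one[of "Re z"] by linarith
  qed
  moreover have "z \<in> cos ` angle_range" if z: "z \<in> arccos_dom" for z
  proof (cases "Im z = 0")
    case True
    then obtain r where r: "z = complex_of_real r"
      by (metis complex_is_Real_iff Reals_cases)
    then have "\<bar>r\<bar> \<le> 1"
      using z by (auto simp: arccos_dom_def)
    then have "cos (complex_of_real (arccos r)) = z"
      using r by (simp add: cos_of_real cos_arccos_abs)
    moreover have "0 \<le> arccos r" "arccos r \<le> pi"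
      using \<open>\<bar>r\<bar> \<le> 1\<close> by (auto intro: arccos_lbound arccos_ubound)
    moreover have "complex_of_real (arccos r) \<in> angle_range"
      using \<open>0 \<le> arccos r\<close> \<open>arccos r \<le> pi\<close>
      by (cases "arccos r = 0"; cases "arccos r = pi") (auto simp: angle_range_def)
    ultimately show ?thesis
      by (metis imageI)
  next
    case False
    define u where "u = Arccos z"
    have u: "cos u = z" "- pi < Re u" "Re u \<le> pi"
      using Re_Arccos_bounds[of z] by (auto simp: u_def)
    have "Im z = sin (Re u) * (exp (- Im u) - exp (Im u)) / 2"
      using u(1) by (auto simp: Im_cos)
    then have "Re u \<noteq> 0" "Re u \<noteq> pi"
      using False by auto
    then consider "0 < Re u" "Re u < pi" | "0 < Re (- u)" "Re (- u) < pi"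
      using u by fastforce
    then show ?thesis
    proof cases
      case 1
      then show ?thesis
        using u(1) by (auto simp: angle_range_def image_iff intro!: bexI[of _ u])
    next
      case 2
      then have "- u \<in> angle_range"
        by (simp add: angle_range_def)
      then show ?thesis
        using u(1) by (metis cos_minus imageI)
    qed
  qed
  ultimately show ?thesis
    by (auto simp: bij_betw_def)
qed

(* Not the library's "Arccos", whose range also contains boundary half-lines. *)
definition angle_arccos :: "complex \<Rightarrow> complex" where
  "angle_arccos = the_inv_into angle_range cos"

definition angle :: "'a::complex_inner \<Rightarrow> 'a \<Rightarrow> complex" where
  "angle x y = angle_arccos (cinner x y / of_real (cnorm x * cnorm y))"

lemma cinner_zero_left [simp]: "cinner 0 y = 0" for y :: "'a::complex_inner"
  using cinner_add_left[of 0 0 y] by simp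

lemma cinner_zero_right [simp]: "cinner y 0 = 0" for y :: "'a::complex_inner"
  by (metis cinner_commute cinner_zero_left complex_cnj_zero)

lemma cinner_minus_left: "cinner (- x) y = - cinner x y" for x y :: "'a::complex_inner"
  using cinner_add_left[of x "- x" y] by (simp add: eq_neg_iff_add_eq_0 add.commute)

lemma cinner_self_ge_0: "0 \<le> Re (cinner x x)" for x :: "'a::complex_inner"
  using cinner_pos[of x] by (cases "x = 0") auto

lemma cinner_self: "cinner x x = of_real ((cnorm x)\<^sup>2)" for x :: "'a::complex_inner"
proof -
  have "Im (cinner x x) = 0"
    using arg_cong[OF cinner_commute[of x x], of Im] by simp
  then show ?thesis
    by (simp add: cnorm_def cinner_self_ge_0 complex_eq_iff)
qed

lemma cnorm_pos: "x \<noteq> 0 \<Longrightarrow> 0 < cnorm x" for x :: "'a::complex_inner"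
  by (simp add: cnorm_def cinner_pos)

lemma norm_cinner_le: "norm (cinner x y) \<le> cnorm x * cnorm y" for x y :: "'a::complex_inner"
proof (cases "y = 0")
  case True
  then show ?thesis by (simp add: cnorm_def)
next
  case False
  define c where "c = cinner x y"
  define d where "d = complex_of_real ((cnorm y)\<^sup>2)"
  define z where "z = d *\<^sub>C x + - (c *\<^sub>C y)"
  have d: "cinner y y = d" "cnj d = d"
    by (simp_all add: d_def cinner_self)
  have pos: "0 < cnorm y"
    using False by (rule cnorm_pos)
  have yx: "cinner y x = cnj c"
    using cinner_commute[of y x] by (simp add: c_def)
  have zl: "cinner z w = d * cinner x w - c * cinner y w" for w
    unfolding z_def by (simp only: cinner_add_left cinner_minus_left cinner_scaleC_left) simp
  have zy: "cinner z y = 0"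
    by (simp add: zl d c_def)
  have "cinner y z = 0"
    using cinner_commute[of y z] zy by simp
  then have "cinner z z = d * cinner x z"
    by (simp add: zl)
  also have "cinner x z = cnj (cinner z x)"
    by (rule cinner_commute)
  also have "\<dots> = d * cinner x x - cnj c * c"
    by (simp add: zl d yx cinner_self)
  finally have "cinner z z = of_real ((cnorm y)\<^sup>2 * ((cnorm y)\<^sup>2 * (cnorm x)\<^sup>2 - (norm c)\<^sup>2))"
    using complex_norm_square[of c] by (simp add: d_def cinner_self mult.commute)
  then have "0 \<le> (cnorm y)\<^sup>2 * ((cnorm y)\<^sup>2 * (cnorm x)\<^sup>2 - (norm c)\<^sup>2)"
    using cinner_self_ge_0[of z] by simp
  then have "(norm c)\<^sup>2 \<le> (cnorm x * cnorm y)\<^sup>2"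
    using pos by (simp add: zero_le_mult_iff power_mult_distrib mult.commute)
  then show ?thesis
    unfolding c_def by (rule power2_le_imp_le) (simp add: cnorm_def cinner_self_ge_0)
qed

lemma angle_in_Reals_iff:
  fixes x y :: "'a::complex_inner"
  assumes "x \<noteq> 0" "y \<noteq> 0"
  shows "angle x y \<in> \<real> \<longleftrightarrow> (x, y) \<in> real_pairs"
proof -
  define m where "m = cnorm x * cnorm y"
  define q where "q = cinner x y / of_real m"
  have m: "m > 0"
    using assms by (simp add: m_def cnorm_pos)
  have q: "norm q \<le> 1"
    using norm_cinner_le[of x y] m by (simp add: q_def m_def norm_divide del: of_real_mult)
  have dom: "q \<in> arccos_dom"
    using q by (auto simp: arccos_dom_def)
  have eq: "cinner x y = of_real m * q"
    using m by (simp add: q_def)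
  have ang: "angle x y = angle_arccos q"
    by (simp add: angle_def q_def m_def)
  have cos: "cos (angle x y) = q"
    using dom bij_betw_cos_angle_range unfolding ang angle_arccos_def
    by (metis bij_betw_def f_the_inv_into_f)
  have "angle x y \<in> \<real> \<longleftrightarrow> q \<in> \<real>"
  proof
    assume "angle x y \<in> \<real>"
    then show "q \<in> \<real>"
      using cos by (metis Reals_cases Reals_of_real cos_of_real)
  next
    assume "q \<in> \<real>"
    then obtain r where r: "q = complex_of_real r"
      by (auto elim: Reals_cases)
    then have "\<bar>r\<bar> \<le> 1"
      using q by simp
    then have "cos (complex_of_real (arccos r)) = q"
      using r by (simp add: cos_of_real cos_arccos_abs)
    moreover have b: "0 \<le> arccos r" "arccos r \<le> pi"
      using \<open>\<bar>r\<bar> \<le> 1\<close> by (auto intro: arccos_lbound arccos_ubound)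
    moreover have "complex_of_real (arccos r) \<in> angle_range"
      using b by (cases "arccos r = 0"; cases "arccos r = pi") (auto simp: angle_range_def)
    ultimately have "angle x y = complex_of_real (arccos r)"
      using bij_betw_cos_angle_range unfolding ang angle_arccos_def
      by (metis bij_betw_def the_inv_into_f_f)
    then show "angle x y \<in> \<real>"
      by simp
  qed
  also have "\<dots> \<longleftrightarrow> cinner x y \<in> \<real>"
    using m by (auto simp: eq complex_is_Real_iff)
  finally show ?thesis
    by (simp add: real_pairs_def)
qed

text \<open>A linearly independent set omits \<open>0\<close>, so for such \<open>B\<close> the condition
  \<open>B \<times> B \<subseteq> real_pairs\<close> says exactly that all angles in \<open>B\<close> are real.\<close>
lemma all_angles_real_iff:
  fixes B :: "'a::complex_inner set"
  assumes "independent B"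
  shows "B \<times> B \<subseteq> real_pairs \<longleftrightarrow> (\<forall>x\<in>B. \<forall>y\<in>B. angle x y \<in> \<real>)"
proof -
  have "0 \<notin> B"
    using assms dependent_zero by blast
  then have "angle x y \<in> \<real> \<longleftrightarrow> (x, y) \<in> real_pairs" if "x \<in> B" "y \<in> B" for x y
    using that angle_in_Reals_iff[of x y] by metis
  then show ?thesis
    by auto
qed

end

theory Submission
  imports Defs
begin

text \<open>Vectors with real pairwise inner products span over \<open>\<real>\<close> a space on which the inner
  product is real, so the Gram-Schmidt process runs with real coefficients and \<open>\<real>\<close>-linear
  independence is enough to keep its residual vectors nonzero.\<close>

lemma cinner_scaleR_left: "cinner (r *\<^sub>R x) y = of_real r * cinner x y"
  for x y :: "'a::complex_inner"
  by (simp add: scaleR_scaleC cinner_scaleC_left)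

lemma cinner_diff_left: "cinner (x - y) z = cinner x z - cinner y z"
  for x y z :: "'a::complex_inner"
  using cinner_add_left[of x "- y" z] by (simp add: cinner_minus_left)

lemma cinner_sum_left: "cinner (sum f A) z = (\<Sum>x\<in>A. cinner (f x) z)"
  for z :: "'a::complex_inner"
  by (induction A rule: infinite_finite_induct) (simp_all add: cinner_add_left)

lemma cinner_scaleR_right: "cinner y (r *\<^sub>R x) = of_real r * cinner y x"
  for x y :: "'a::complex_inner"
  using cinner_commute[of y "r *\<^sub>R x"] cinner_commute[of y x]
  by (simp add: cinner_scaleR_left)

lemma cinner_eq_0_commute: "cinner x y = 0 \<longleftrightarrow> cinner y x = 0"
  for x y :: "'a::complex_inner"
  using cinner_commute[of x y] cinner_commute[of y x] by auto

lemma subspace_orthogonal_to_vector: "subspace {x. cinner x y = 0}"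
  for y :: "'a::complex_inner"
  by (rule subspaceI) (auto simp: cinner_add_left cinner_scaleR_left)

text \<open>Reality of an inner product survives real linear combinations, though not complex ones.
  With \<open>span_minimal\<close> it passes from a set to its real span.\<close>

lemma subspace_real_pairs: "subspace {x. (x, y) \<in> real_pairs}"
  for y :: "'a::complex_inner"
  by (rule subspaceI) (auto simp: real_pairs_def cinner_add_left cinner_scaleR_left)

lemma real_pairs_sym: "(x, y) \<in> real_pairs \<Longrightarrow> (y, x) \<in> real_pairs"
  using cinner_commute[of y x] by (simp add: real_pairs_def complex_is_Real_iff)

text \<open>A member lying in the real span of the others would be orthogonal to itself, against
  \<open>cinner t t = 1\<close>.\<close>

lemma orthonormal_system_independent:
  assumes "orthonormal_system T"
  shows "independent T"
proof
  assume "dependent T"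
  then obtain t where t: "t \<in> T" "t \<in> span (T - {t})"
    by (auto simp: dependent_def)
  have "span (T - {t}) \<subseteq> {x. cinner x t = 0}"
    using assms t(1)
    by (intro span_minimal subspace_orthogonal_to_vector) (auto simp: orthonormal_system_def)
  then show False
    using assms t by (force simp: orthonormal_system_def)
qed

lemma orthonormal_system_real_pairs:
  assumes "orthonormal_system T"
  shows "T \<times> T \<subseteq> real_pairs"
proof clarify
  fix x y assume "x \<in> T" "y \<in> T"
  then show "(x, y) \<in> real_pairs"
    using assms by (cases "x = y") (auto simp: orthonormal_system_def real_pairs_def)
qed

lemma cinner_normalize:
  fixes u :: "'a::complex_inner"
  assumes "u \<noteq> 0"
  shows "cinner (u /\<^sub>R cnorm u) (u /\<^sub>R cnorm u) = 1"
  using cnorm_pos[OF assms]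
  by (simp add: cinner_scaleR_left cinner_scaleR_right cinner_self[of u] power2_eq_square field_simps)

text \<open>The case \<open>T = {}\<close> lets an induction start from the empty set, which is not
  an orthonormal system by definition.\<close>

lemma orthonormal_system_insert:
  assumes "T = {} \<or> orthonormal_system T" "cinner e e = 1" "\<And>t. t \<in> T \<Longrightarrow> cinner e t = 0"
  shows "orthonormal_system (insert e T)"
  using assms cinner_eq_0_commute[of e] by (auto simp: orthonormal_system_def)

text \<open>The conclusion \<open>T \<subseteq> span B\<close> strengthens the induction: it keeps
  the projection of the next vector inside \<open>span B\<close> and its coefficients real.\<close>

lemma real_gram_schmidt:
  fixes B :: "'a::complex_inner set"
  assumes "finite B" "independent B" "B \<times> B \<subseteq> real_pairs"
  shows "\<exists>T. (T = {} \<or> orthonormal_system T) \<and> finite T \<and> card T = card B \<and> T \<subseteq> span B"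
  using assms
proof (induction B rule: finite_induct)
  case empty
  then show ?case by auto
next
  case (insert b B)
  then have b: "b \<notin> span B" and "independent B" "B \<times> B \<subseteq> real_pairs"
    by (auto simp: independent_insert split: if_splits)
  then obtain T where T: "T = {} \<or> orthonormal_system T" "finite T" "card T = card B"
      "T \<subseteq> span B"
    using insert.IH by auto
  \<comment> \<open>\<open>p\<close> is the orthogonal projection of \<open>b\<close> onto the real
    span of \<open>T\<close>. Taking \<open>Re\<close> makes the coefficients real scalars by
    construction; that it changes no value is shown within \<open>u_orth\<close>.\<close>
  define p where "p = (\<Sum>t\<in>T. Re (cinner b t) *\<^sub>R t)"
  define u where "u = b - p"
  define e where "e = u /\<^sub>R cnorm u"
  have p: "p \<in> span B"
    unfolding p_def using T(4) by (intro span_sum span_scale) auto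
  \<comment> \<open>Otherwise \<open>b = p\<close> would lie in \<open>span B\<close>.\<close>
  have u: "u \<noteq> 0"
    using b p by (auto simp: u_def)
  have u_orth: "cinner u t = 0" if t: "t \<in> T" for t
  proof -
    \<comment> \<open>The hypothesis on pairs enters here: \<open>b\<close> has real inner products
      with all of \<open>B\<close>, hence with \<open>span B\<close>, which contains
      \<open>t\<close>.\<close>
    have "span B \<subseteq> {x. (x, b) \<in> real_pairs}"
      using insert.prems(2) by (intro span_minimal subspace_real_pairs) auto
    then have "(b, t) \<in> real_pairs"
      using t T(4) real_pairs_sym by auto
    then have real: "of_real (Re (cinner b t)) = cinner b t"
      by (simp add: real_pairs_def)
    have "cinner p t = (\<Sum>s\<in>T. if s = t then of_real (Re (cinner b t)) else 0)"
      unfolding p_def cinner_sum_left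
      using T(1) t by (intro sum.cong) (auto simp: cinner_scaleR_left orthonormal_system_def)
    also have "\<dots> = cinner b t"
      using T(2) t real by simp
    finally show ?thesis
      by (simp add: u_def cinner_diff_left)
  qed
  have orth: "orthonormal_system (insert e T)"
    using T(1) cinner_normalize[OF u, folded e_def]
    by (rule orthonormal_system_insert) (simp add: e_def cinner_scaleR_left u_orth)
  \<comment> \<open>A member of \<open>T\<close> is orthogonal to \<open>u\<close>, so
    \<open>e \<in> T\<close> would give \<open>cinner e e = 0\<close> instead of 1. Thus the
    cardinality grows by one.\<close>
  have "e \<notin> T"
    using u u_orth[of e] cinner_normalize[OF u] by (auto simp: e_def cinner_scaleR_left)
  moreover have "e \<in> span (insert b B)"
    unfolding e_def u_def
    using p span_mono[OF subset_insertI, of B b]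
    by (intro span_scale span_diff) (auto intro: span_base)
  moreover have "T \<subseteq> span (insert b B)"
    using T(4) span_mono[OF subset_insertI, of B b] by auto
  ultimately show ?case
    using T insert.hyps orth by (intro exI[of _ "insert e T"]) auto
qed

theorem proposition4p4:
  fixes n :: nat
  assumes "n \<ge> 1"
  shows "(\<exists>T :: 'a::complex_inner set. orthonormal_system T \<and> card T = n) \<longleftrightarrow>
         (\<exists>B :: 'a set. card B = n \<and> independent B \<and> B \<times> B \<subseteq> real_pairs)"
proof
  assume "\<exists>T :: 'a set. orthonormal_system T \<and> card T = n"
  \<comment> \<open>The orthonormal system itself serves as \<open>B\<close>.\<close>
  then show "\<exists>B :: 'a set. card B = n \<and> independent B \<and> B \<times> B \<subseteq> real_pairs"
    using orthonormal_system_independent orthonormal_system_real_pairs by blast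
next
  assume "\<exists>B :: 'a set. card B = n \<and> independent B \<and> B \<times> B \<subseteq> real_pairs"
  then obtain B :: "'a set" where B: "card B = n" "independent B" "B \<times> B \<subseteq> real_pairs"
    by blast
  \<comment> \<open>Infinite sets have \<open>card\<close> 0, so \<open>n \<ge> 1\<close> forces
    finiteness.\<close>
  moreover have "finite B"
    using B(1) assms by (intro card_ge_0_finite) simp
  ultimately obtain T :: "'a set" where "T = {} \<or> orthonormal_system T" "card T = n"
    using real_gram_schmidt by blast
  \<comment> \<open>Since \<open>card T = n \<ge> 1\<close>, the alternative \<open>T = {}\<close>
    is excluded.\<close>
  then show "\<exists>T :: 'a set. orthonormal_system T \<and> card T = n"
    using assms by auto
qed

end
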